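(* Let $\mathcal{E}$ be a category with images and pullbacks, and let $f:E\to E$ be a morphism of $\mathcal{E}$ such that $f\circ f=\mathrm{id}_E$. Define an operator on subobjects $M$ of $E$ by means of the equation $$\overline{M}:=M\vee f(M).$$ Then this operator is a Kuratowski closure, i.e.: (1) if $M$ is a subobject of $E$ in $\mathcal{E}$, then $M\leq\overline{M}$; (2) if $M$ is a subobject of $E$ in $\mathcal{E}$, then $\overline{\overline{M}}=\overline{M}$; (3) if $M$ and $M'$ are subobjects of $E$ in $\mathcal{E}$, then $\overline{M\vee M'}=\overline{M}\vee\overline{M'}$.
   Context: For a subobject $M$ of $E$, $f(M)$ denotes the image of $M$ under $f$ (direct image of subobjects), $\leq$ denotes the order on subobjects of $E$, and $\vee$ denotes the join of subobjects of $E$. *)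

theory Defs
  imports Main
begin

record ('o, 'm) cat =
  Obj :: "'o set"
  Arr :: "'m set"
  Dom :: "'m \<Rightarrow> 'o"
  Cod :: "'m \<Rightarrow> 'o"
  Ident :: "'o \<Rightarrow> 'm"
  Comp :: "'m \<Rightarrow> 'm \<Rightarrow> 'm" (infixl "\<cdot>\<index>" 70)

definition Hom :: "('o, 'm) cat \<Rightarrow> 'o \<Rightarrow> 'o \<Rightarrow> 'm set" where
  "Hom C A B = {g \<in> Arr C. Dom C g = A \<and> Cod C g = B}"

locale category =
  fixes C :: "('o, 'm) cat" (structure)
  assumes Dom_in_Obj: "g \<in> Arr C \<Longrightarrow> Dom C g \<in> Obj C"
    and Cod_in_Obj: "g \<in> Arr C \<Longrightarrow> Cod C g \<in> Obj C"
    and Ident_in_Hom: "A \<in> Obj C \<Longrightarrow> Ident C A \<in> Hom C A A"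
    and Comp_in_Hom: "h \<in> Hom C B D \<Longrightarrow> g \<in> Hom C A B \<Longrightarrow> h \<cdot> g \<in> Hom C A D"
    and Comp_Ident: "g \<in> Hom C A B \<Longrightarrow> g \<cdot> Ident C A = g"
    and Ident_Comp: "g \<in> Hom C A B \<Longrightarrow> Ident C B \<cdot> g = g"
    and Comp_assoc: "k \<in> Hom C D F \<Longrightarrow> h \<in> Hom C B D \<Longrightarrow> g \<in> Hom C A B
      \<Longrightarrow> (k \<cdot> h) \<cdot> g = k \<cdot> (h \<cdot> g)"

definition Monos :: "('o, 'm) cat \<Rightarrow> 'o \<Rightarrow> 'm set" where
  "Monos C E = {m \<in> Arr C. Cod C m = E \<and>
     (\<forall>A \<in> Obj C. \<forall>g \<in> Hom C A (Dom C m). \<forall>h \<in> Hom C A (Dom C m).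
        m \<cdot>\<^bsub>C\<^esub> g = m \<cdot>\<^bsub>C\<^esub> h \<longrightarrow> g = h)}"

definition factors_through :: "('o, 'm) cat \<Rightarrow> 'm \<Rightarrow> 'm \<Rightarrow> bool" where
  "factors_through C g m \<longleftrightarrow> (\<exists>h \<in> Hom C (Dom C g) (Dom C m). m \<cdot>\<^bsub>C\<^esub> h = g)"

text \<open>A subobject of \<open>E\<close> is an equivalence class of monomorphisms into \<open>E\<close>, two of them being
  equivalent when each factors through the other.\<close>

definition subobject_of :: "('o, 'm) cat \<Rightarrow> 'm \<Rightarrow> 'm set" where
  "subobject_of C m =
     {n \<in> Monos C (Cod C m). factors_through C m n \<and> factors_through C n m}"

definition Sub :: "('o, 'm) cat \<Rightarrow> 'o \<Rightarrow> 'm set set" where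
  "Sub C E = subobject_of C ` Monos C E"

definition sub_le :: "('o, 'm) cat \<Rightarrow> 'm set \<Rightarrow> 'm set \<Rightarrow> bool" where
  "sub_le C M N \<longleftrightarrow> (\<exists>m \<in> M. \<exists>n \<in> N. factors_through C m n)"

text \<open>The image of a morphism is the least subobject of its codomain through which it factors;
  no stability under pullback is required.\<close>

definition is_image :: "('o, 'm) cat \<Rightarrow> 'm \<Rightarrow> 'm \<Rightarrow> bool" where
  "is_image C g i \<longleftrightarrow> i \<in> Monos C (Cod C g) \<and> factors_through C g i \<and>
     (\<forall>n \<in> Monos C (Cod C g). factors_through C g n \<longrightarrow> factors_through C i n)"

definition has_images :: "('o, 'm) cat \<Rightarrow> bool" where
  "has_images C \<longleftrightarrow> (\<forall>g \<in> Arr C. \<exists>i. is_image C g i)"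

definition is_pullback :: "('o, 'm) cat \<Rightarrow> 'm \<Rightarrow> 'm \<Rightarrow> 'm \<Rightarrow> 'm \<Rightarrow> bool" where
  "is_pullback C g h p q \<longleftrightarrow>
     p \<in> Hom C (Dom C p) (Dom C g) \<and> q \<in> Hom C (Dom C p) (Dom C h) \<and>
     g \<cdot>\<^bsub>C\<^esub> p = h \<cdot>\<^bsub>C\<^esub> q \<and>
     (\<forall>A \<in> Obj C. \<forall>u \<in> Hom C A (Dom C g). \<forall>v \<in> Hom C A (Dom C h).
        g \<cdot>\<^bsub>C\<^esub> u = h \<cdot>\<^bsub>C\<^esub> v \<longrightarrow>
        (\<exists>!w. w \<in> Hom C A (Dom C p) \<and> p \<cdot>\<^bsub>C\<^esub> w = u \<and> q \<cdot>\<^bsub>C\<^esub> w = v))"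

definition has_pullbacks :: "('o, 'm) cat \<Rightarrow> bool" where
  "has_pullbacks C \<longleftrightarrow>
     (\<forall>g \<in> Arr C. \<forall>h \<in> Arr C. Cod C g = Cod C h \<longrightarrow> (\<exists>p q. is_pullback C g h p q))"

text \<open>The subobject \<open>f(M)\<close> is the image of \<open>f \<cdot> m\<close> for a monomorphism \<open>m\<close> representing \<open>M\<close>;
  it does not depend on the choice of \<open>m\<close>.\<close>

definition direct_image :: "('o, 'm) cat \<Rightarrow> 'm \<Rightarrow> 'm set \<Rightarrow> 'm set" where
  "direct_image C f M =
     (THE N. \<exists>m \<in> M. \<exists>i. is_image C (f \<cdot>\<^bsub>C\<^esub> m) i \<and> N = subobject_of C i)"

definition is_join :: "('o, 'm) cat \<Rightarrow> 'o \<Rightarrow> 'm set \<Rightarrow> 'm set \<Rightarrow> 'm set \<Rightarrow> bool" where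
  "is_join C E M N J \<longleftrightarrow> J \<in> Sub C E \<and> sub_le C M J \<and> sub_le C N J \<and>
     (\<forall>K \<in> Sub C E. sub_le C M K \<and> sub_le C N K \<longrightarrow> sub_le C J K)"

text \<open>Images and pullbacks do not guarantee joins, so the value \<open>join C E M N\<close> is meaningful only
  together with \<open>has_join C E M N\<close>.\<close>

definition has_join :: "('o, 'm) cat \<Rightarrow> 'o \<Rightarrow> 'm set \<Rightarrow> 'm set \<Rightarrow> bool" where
  "has_join C E M N \<longleftrightarrow> (\<exists>J. is_join C E M N J)"

definition join :: "('o, 'm) cat \<Rightarrow> 'o \<Rightarrow> 'm set \<Rightarrow> 'm set \<Rightarrow> 'm set" where
  "join C E M N = (THE J. is_join C E M N J)"

definition image_closure :: "('o, 'm) cat \<Rightarrow> 'o \<Rightarrow> 'm \<Rightarrow> 'm set \<Rightarrow> 'm set" where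
  "image_closure C E f M = join C E M (direct_image C f M)"

end

theory Submission
  imports Defs
begin

text \<open>
  Since \<open>f\<close> is its own inverse, composing with \<open>f\<close> turns monomorphisms into monomorphisms, so the
  image of \<open>f \<cdot> m\<close> is represented by \<open>f \<cdot> m\<close> itself. Direct image along \<open>f\<close> is therefore a
  monotone involution of the partially ordered class of subobjects of \<open>E\<close>, and the claim becomes a
  statement of pure order theory.

  In an ordered class with a monotone involution \<open>\<phi>\<close>, call \<open>N\<close> stable when \<open>\<phi> N \<le> N\<close>. The element
  \<open>M \<or> \<phi> M\<close> is stable, because \<open>\<phi>\<close> exchanges \<open>M\<close> and \<open>\<phi> M\<close> and so preserves their join
  (lemma \<open>closure_stable\<close>); any stable \<open>N\<close> above \<open>M\<close> also lies above \<open>\<phi> M\<close>. Hence \<open>M \<or> \<phi> M\<close> is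
  the least stable element above \<open>M\<close>, which gives extensivity and idempotence.
  For additivity, let \<open>J = M \<or> M'\<close> and let \<open>K\<close>, not necessarily stable, be above the closures of
  \<open>M\<close> and \<open>M'\<close>. Then both \<open>M\<close> and \<open>M'\<close> are below \<open>K\<close> and below \<open>\<phi> K\<close>, hence so is \<open>J\<close>; so \<open>J\<close> and
  \<open>\<phi> J\<close> are below \<open>K\<close>. Thus the closure of \<open>J\<close> is a join of the closures (lemma
  \<open>is_join_closure_join\<close>); in particular the closures have a join.
\<close>

section \<open>The order on subobjects\<close>

context category
begin

lemma MonosD:
  assumes "m \<in> Monos C E"
  shows "m \<in> Hom C (Dom C m) E" "m \<in> Arr C" "Cod C m = E"
  using assms by (auto simp: Monos_def Hom_def)

lemma Monos_cancel:
  assumes "m \<in> Monos C E" "g \<in> Hom C A (Dom C m)" "h \<in> Hom C A (Dom C m)" "m \<cdot> g = m \<cdot> h"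
  shows "g = h"
proof -
  have "A \<in> Obj C"
    using assms(2) Dom_in_Obj by (auto simp: Hom_def)
  then show ?thesis
    using assms by (auto simp: Monos_def)
qed

lemma Comp_Dom_Cod:
  assumes "h \<in> Hom C B D" "g \<in> Hom C A B"
  shows "h \<cdot> g \<in> Arr C" "Dom C (h \<cdot> g) = A" "Cod C (h \<cdot> g) = D"
  using Comp_in_Hom[OF assms] by (auto simp: Hom_def)

lemma factors_through_refl:
  assumes "g \<in> Arr C"
  shows "factors_through C g g"
  using Ident_in_Hom[OF Dom_in_Obj[OF assms]] Comp_Ident[of g "Dom C g" "Cod C g"] assms
  by (auto simp: factors_through_def Hom_def)

lemma factors_through_trans:
  assumes "factors_through C g h" "factors_through C h k" "k \<in> Arr C"
  shows "factors_through C g k"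
proof -
  obtain u v where u: "u \<in> Hom C (Dom C g) (Dom C h)" "h \<cdot> u = g"
    and v: "v \<in> Hom C (Dom C h) (Dom C k)" "k \<cdot> v = h"
    using assms by (auto simp: factors_through_def)
  have "k \<in> Hom C (Dom C k) (Cod C k)"
    using assms(3) by (simp add: Hom_def)
  then have "k \<cdot> (v \<cdot> u) = g"
    using Comp_assoc v u by metis
  then show ?thesis
    using Comp_in_Hom[OF v(1) u(1)] by (auto simp: factors_through_def)
qed

lemma Comp_factors_through:
  assumes "k \<in> Hom C D F" "h \<in> Hom C (Dom C h) D" "factors_through C g h"
  shows "factors_through C (k \<cdot> g) (k \<cdot> h)"
proof -
  obtain u where u: "u \<in> Hom C (Dom C g) (Dom C h)" "h \<cdot> u = g"
    using assms(3) by (auto simp: factors_through_def)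
  have "g \<in> Hom C (Dom C g) D"
    using Comp_in_Hom[OF assms(2) u(1)] u(2) by simp
  then have "Dom C (k \<cdot> g) = Dom C g" "Dom C (k \<cdot> h) = Dom C h"
    using Comp_Dom_Cod(2)[OF assms(1)] assms(2) by blast+
  moreover have "(k \<cdot> h) \<cdot> u = k \<cdot> g"
    using Comp_assoc[OF assms(1,2) u(1)] u(2) by simp
  ultimately show ?thesis
    using u(1) unfolding factors_through_def by auto
qed

lemma subobject_of_Monos:
  assumes "m \<in> Monos C E"
  shows "n \<in> subobject_of C m \<longleftrightarrow>
    n \<in> Monos C E \<and> factors_through C m n \<and> factors_through C n m"
  using MonosD[OF assms] by (auto simp: subobject_of_def)

lemma subobject_of_in_Sub: "m \<in> Monos C E \<Longrightarrow> subobject_of C m \<in> Sub C E"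
  by (simp add: Sub_def)

lemma SubE:
  assumes "M \<in> Sub C E"
  obtains m where "m \<in> Monos C E" "M = subobject_of C m"
  using assms by (auto simp: Sub_def)

lemma self_in_subobject_of: "m \<in> Monos C E \<Longrightarrow> m \<in> subobject_of C m"
  by (simp add: subobject_of_Monos factors_through_refl MonosD(2))

lemma subobject_of_eqI:
  assumes "m \<in> Monos C E" "n \<in> Monos C E" "factors_through C m n" "factors_through C n m"
  shows "subobject_of C m = subobject_of C n"
proof -
  have le: "subobject_of C k \<subseteq> subobject_of C l"
    if "k \<in> Monos C E" "l \<in> Monos C E" "factors_through C k l" "factors_through C l k" for k l
  proof
    fix x assume "x \<in> subobject_of C k"
    then have x: "x \<in> Monos C E" "factors_through C k x" "factors_through C x k"
      using subobject_of_Monos[OF that(1)] by auto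
    show "x \<in> subobject_of C l"
      using x factors_through_trans[OF that(4) x(2) MonosD(2)[OF x(1)]]
        factors_through_trans[OF x(3) that(3) MonosD(2)[OF that(2)]]
      by (simp add: subobject_of_Monos[OF that(2)])
  qed
  show ?thesis
    using le[OF assms] le[OF assms(2,1,4,3)] by blast
qed

lemma sub_le_subobject_of:
  assumes "m \<in> Monos C E" "n \<in> Monos C E"
  shows "sub_le C (subobject_of C m) (subobject_of C n) \<longleftrightarrow> factors_through C m n"
proof
  assume "sub_le C (subobject_of C m) (subobject_of C n)"
  then show "factors_through C m n"
    using assms unfolding sub_le_def
    by (meson MonosD(2) factors_through_trans subobject_of_Monos)
next
  assume "factors_through C m n"
  then show "sub_le C (subobject_of C m) (subobject_of C n)"
    using assms self_in_subobject_of unfolding sub_le_def by blast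
qed

lemma sub_le_refl:
  assumes "M \<in> Sub C E"
  shows "sub_le C M M"
proof -
  obtain m where "m \<in> Monos C E" "M = subobject_of C m"
    using assms by (rule SubE)
  then show ?thesis
    by (simp add: sub_le_subobject_of factors_through_refl MonosD(2))
qed

lemma sub_le_trans:
  assumes "M \<in> Sub C E" "N \<in> Sub C E" "K \<in> Sub C E" "sub_le C M N" "sub_le C N K"
  shows "sub_le C M K"
proof -
  obtain m n k where m: "m \<in> Monos C E" "M = subobject_of C m"
    and n: "n \<in> Monos C E" "N = subobject_of C n"
    and k: "k \<in> Monos C E" "K = subobject_of C k"
    using assms(1-3) by (elim SubE)
  have "factors_through C m n" "factors_through C n k"
    using assms(4,5) m(2) n(2) k(2) sub_le_subobject_of[OF m(1) n(1)]
      sub_le_subobject_of[OF n(1) k(1)] by simp_all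
  then have "factors_through C m k"
    by (rule factors_through_trans) (rule MonosD(2)[OF k(1)])
  then show ?thesis
    using m(2) k(2) sub_le_subobject_of[OF m(1) k(1)] by simp
qed

lemma sub_le_antisym:
  assumes "M \<in> Sub C E" "N \<in> Sub C E" "sub_le C M N" "sub_le C N M"
  shows "M = N"
  proof -
  obtain m n where m: "m \<in> Monos C E" "M = subobject_of C m"
    and n: "n \<in> Monos C E" "N = subobject_of C n"
    using assms(1,2) by (elim SubE)
  then show ?thesis
    using assms(3,4) subobject_of_eqI[OF m(1) n(1)]
    by (simp add: sub_le_subobject_of[OF m(1) n(1)] sub_le_subobject_of[OF n(1) m(1)])
qed

lemma join_eqI:
  assumes "is_join C E M N J"
  shows "join C E M N = J"
  unfolding join_def
proof (rule the_equality)
  show "is_join C E M N J"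
    by (rule assms)
next
  fix J' assume "is_join C E M N J'"
  with assms show "J' = J"
    using sub_le_antisym[of J' E J] by (simp add: is_join_def)
qed

lemma is_join_join: "has_join C E M N \<Longrightarrow> is_join C E M N (join C E M N)"
  unfolding has_join_def using join_eqI by metis

section \<open>Direct images of subobjects along monomorphisms\<close>

lemma Comp_in_Monos:
  assumes k: "k \<in> Monos C F" "Dom C k = D" and m: "m \<in> Monos C D"
  shows "k \<cdot> m \<in> Monos C F"
proof -
  note kH = MonosD(1)[OF k(1), unfolded k(2)] and mH = MonosD(1)[OF m]
  have "g = h" if g: "g \<in> Hom C A (Dom C m)" and h: "h \<in> Hom C A (Dom C m)"
    and eq: "(k \<cdot> m) \<cdot> g = (k \<cdot> m) \<cdot> h" for A g h
  proof -
    have "k \<cdot> (m \<cdot> g) = k \<cdot> (m \<cdot> h)"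
      using eq Comp_assoc[OF kH mH g] Comp_assoc[OF kH mH h] by simp
    then have "m \<cdot> g = m \<cdot> h"
      using Monos_cancel[OF k(1)] Comp_in_Hom[OF mH] g h k(2) by metis
    then show ?thesis
      by (rule Monos_cancel[OF m g h])
  qed
  then show ?thesis
    using Comp_Dom_Cod[OF kH mH] by (simp add: Monos_def)
qed

lemma is_image_Monos:
  assumes "m \<in> Monos C E"
  shows "is_image C m m"
  using assms by (simp add: is_image_def MonosD(3)[OF assms] factors_through_refl MonosD(2))

text \<open>Images are determined only up to equivalence of monomorphisms, and \<open>m\<close> may be replaced by any
  other representative; both choices are absorbed by passing to the class of \<open>k \<cdot> m\<close>, so the
  definite description in the direct image has a unique solution.\<close>

lemma direct_image_subobject_of:
  assumes k: "k \<in> Monos C F" "Dom C k = D" and m: "m \<in> Monos C D"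
  shows "direct_image C k (subobject_of C m) = subobject_of C (k \<cdot> m)"
  unfolding direct_image_def
proof (rule the_equality)
  have "is_image C (k \<cdot> m) (k \<cdot> m)"
    using is_image_Monos Comp_in_Monos assms by blast
  then show "\<exists>n\<in>subobject_of C m. \<exists>i. is_image C (k \<cdot> n) i \<and>
      subobject_of C (k \<cdot> m) = subobject_of C i"
    using self_in_subobject_of[OF m] by blast
next
  fix N
  assume "\<exists>n\<in>subobject_of C m. \<exists>i. is_image C (k \<cdot> n) i \<and> N = subobject_of C i"
  then obtain n i where n: "n \<in> subobject_of C m" and i: "is_image C (k \<cdot> n) i"
    and N: "N = subobject_of C i"
    by blast
  note kH = MonosD(1)[OF k(1), unfolded k(2)]
  have n': "n \<in> Monos C D" "factors_through C m n" "factors_through C n m"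
    using n subobject_of_Monos[OF m] by auto
  have kn: "k \<cdot> n \<in> Monos C F" and km: "k \<cdot> m \<in> Monos C F"
    using Comp_in_Monos k m n' by auto
  have iM: "i \<in> Monos C F" "factors_through C (k \<cdot> n) i" "factors_through C i (k \<cdot> n)"
    using i MonosD(3)[OF kn] is_image_Monos[OF kn] by (simp_all add: is_image_def)
  have "subobject_of C i = subobject_of C (k \<cdot> n)"
    using subobject_of_eqI iM kn by blast
  also have "\<dots> = subobject_of C (k \<cdot> m)"
  proof (rule subobject_of_eqI[OF kn km])
    show "factors_through C (k \<cdot> n) (k \<cdot> m)"
      using Comp_factors_through[OF kH MonosD(1)[OF m] n'(3)] .
    show "factors_through C (k \<cdot> m) (k \<cdot> n)"
      using Comp_factors_through[OF kH MonosD(1)[OF n'(1)] n'(2)] .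
  qed
  finally show "N = subobject_of C (k \<cdot> m)"
    using N by simp
qed

lemma direct_image_in_Sub:
  assumes "k \<in> Monos C F" "Dom C k = D" "M \<in> Sub C D"
  shows "direct_image C k M \<in> Sub C F"
  using assms(3)
  by (elim SubE) (simp add: direct_image_subobject_of[OF assms(1,2)] subobject_of_in_Sub
      Comp_in_Monos[OF assms(1,2)])

lemma direct_image_mono:
  assumes k: "k \<in> Monos C F" "Dom C k = D" and M: "M \<in> Sub C D" and N: "N \<in> Sub C D"
    and le: "sub_le C M N"
  shows "sub_le C (direct_image C k M) (direct_image C k N)"
proof -
  obtain m n where m: "m \<in> Monos C D" "M = subobject_of C m"
    and n: "n \<in> Monos C D" "N = subobject_of C n"
    using M N by (elim SubE)
  have "factors_through C (k \<cdot> m) (k \<cdot> n)"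
    using le m(2) n(2) sub_le_subobject_of[OF m(1) n(1)]
      Comp_factors_through[OF MonosD(1)[OF k(1), unfolded k(2)] MonosD(1)[OF n(1)]] by simp
  then show ?thesis
    using m n by (simp add: direct_image_subobject_of[OF k]
        sub_le_subobject_of[OF Comp_in_Monos[OF k] Comp_in_Monos[OF k]])
qed

end

section \<open>The closure operator of an involution\<close>

locale involution = category C for C :: "('o, 'm) cat" (structure) +
  fixes E :: 'o and f :: 'm
  assumes f_in_Hom: "f \<in> Hom C E E"
    and f_f: "f \<cdot> f = Ident C E"
    and has_join_direct_image: "M \<in> Sub C E \<Longrightarrow> has_join C E M (direct_image C f M)"
begin

abbreviation "\<phi> \<equiv> direct_image C f"
abbreviation "cl \<equiv> image_closure C E f"

lemma f_f_Comp: "g \<in> Hom C A E \<Longrightarrow> f \<cdot> (f \<cdot> g) = g"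
  using Comp_assoc[OF f_in_Hom f_in_Hom, of g A] f_f Ident_Comp by simp

lemma f_in_Monos: "f \<in> Monos C E" and Dom_f: "Dom C f = E"
proof -
  show "Dom C f = E"
    using f_in_Hom by (simp add: Hom_def)
  have "g = h" if "g \<in> Hom C A E" "h \<in> Hom C A E" "f \<cdot> g = f \<cdot> h" for A g h
    using that f_f_Comp by metis
  then show "f \<in> Monos C E"
    using f_in_Hom by (simp add: Monos_def Hom_def)
qed

lemmas phi_in_Sub = direct_image_in_Sub[OF f_in_Monos Dom_f]
lemmas phi_mono = direct_image_mono[OF f_in_Monos Dom_f]

lemma phi_phi:
  assumes "M \<in> Sub C E"
  shows "\<phi> (\<phi> M) = M"
  using assms
  by (elim SubE) (simp add: direct_image_subobject_of[OF f_in_Monos Dom_f]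
      Comp_in_Monos[OF f_in_Monos Dom_f] f_f_Comp[OF MonosD(1)])

text \<open>A monotone involution is its own adjoint.\<close>

lemma phi_le_iff:
  assumes "M \<in> Sub C E" "N \<in> Sub C E"
  shows "sub_le C (\<phi> M) N \<longleftrightarrow> sub_le C M (\<phi> N)"
  using phi_mono[OF phi_in_Sub[OF assms(1)] assms(2)] phi_mono[OF assms(1) phi_in_Sub[OF assms(2)]]
  by (auto simp: phi_phi assms)

lemma is_join_closure: "M \<in> Sub C E \<Longrightarrow> is_join C E M (\<phi> M) (cl M)"
  unfolding image_closure_def by (rule is_join_join[OF has_join_direct_image])

lemma closure_in_Sub: "M \<in> Sub C E \<Longrightarrow> cl M \<in> Sub C E"
  and le_closure: "M \<in> Sub C E \<Longrightarrow> sub_le C M (cl M)"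
  and phi_le_closure: "M \<in> Sub C E \<Longrightarrow> sub_le C (\<phi> M) (cl M)"
  and closure_least: "M \<in> Sub C E \<Longrightarrow> K \<in> Sub C E \<Longrightarrow> sub_le C M K \<Longrightarrow> sub_le C (\<phi> M) K
    \<Longrightarrow> sub_le C (cl M) K"
  using is_join_closure unfolding is_join_def by blast+

lemma closure_stable:
  assumes M: "M \<in> Sub C E"
  shows "sub_le C (\<phi> (cl M)) (cl M)"
proof -
  have "sub_le C (\<phi> M) (\<phi> (cl M))"
    using M by (intro phi_mono closure_in_Sub le_closure)
  moreover have "sub_le C M (\<phi> (cl M))"
    using phi_le_closure[OF M] phi_le_iff[OF M closure_in_Sub[OF M]] by simp
  ultimately show ?thesis
    using phi_le_iff[OF closure_in_Sub[OF M] closure_in_Sub[OF M]]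
      closure_least[OF M phi_in_Sub[OF closure_in_Sub[OF M]]] by simp
qed

lemma closure_idem:
  assumes M: "M \<in> Sub C E"
  shows "cl (cl M) = cl M"
proof -
  note cM = closure_in_Sub[OF M]
  have "sub_le C (cl (cl M)) (cl M)"
    using closure_least[OF cM cM sub_le_refl[OF cM] closure_stable[OF M]] .
  then show ?thesis
    using sub_le_antisym[OF closure_in_Sub[OF cM] cM] le_closure[OF cM] by simp
qed

lemma closure_mono:
  assumes M: "M \<in> Sub C E" and N: "N \<in> Sub C E" and le: "sub_le C M N"
  shows "sub_le C (cl M) (cl N)"
proof (rule closure_least[OF M closure_in_Sub[OF N]])
  show "sub_le C M (cl N)"
    using sub_le_trans[OF M N closure_in_Sub[OF N] le le_closure[OF N]] .
  show "sub_le C (\<phi> M) (cl N)"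
    using sub_le_trans[OF phi_in_Sub[OF M] phi_in_Sub[OF N] closure_in_Sub[OF N]]
      phi_mono[OF M N le] phi_le_closure[OF N] by blast
qed

text \<open>An upper bound \<open>K\<close> of the two closures need not be stable, so leastness of the closure of \<open>J\<close>
  among stable subobjects does not suffice; instead \<open>J\<close> is compared with both \<open>K\<close> and \<open>\<phi> K\<close>.\<close>

lemma is_join_closure_join:
  assumes M: "M \<in> Sub C E" and M': "M' \<in> Sub C E" and J: "is_join C E M M' J"
  shows "is_join C E (cl M) (cl M') (cl J)"
proof -
  have JS: "J \<in> Sub C E" and le: "sub_le C M J" "sub_le C M' J"
    and least: "\<And>K. K \<in> Sub C E \<Longrightarrow> sub_le C M K \<Longrightarrow> sub_le C M' K \<Longrightarrow> sub_le C J K"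
    using J by (auto simp: is_join_def)
  have below: "sub_le C N K \<and> sub_le C N (\<phi> K)"
    if N: "N \<in> Sub C E" and K: "K \<in> Sub C E" and NK: "sub_le C (cl N) K" for N K
  proof
    show "sub_le C N K"
      using sub_le_trans[OF N closure_in_Sub[OF N] K le_closure[OF N] NK] .
    have "sub_le C (\<phi> N) K"
      using sub_le_trans[OF phi_in_Sub[OF N] closure_in_Sub[OF N] K phi_le_closure[OF N] NK] .
    then show "sub_le C N (\<phi> K)"
      using phi_le_iff[OF N K] by blast
  qed
  have "sub_le C (cl J) K"
    if K: "K \<in> Sub C E" and "sub_le C (cl M) K" "sub_le C (cl M') K" for K
  proof (rule closure_least[OF JS K])
    show "sub_le C J K"
      using that below[OF M K] below[OF M' K] least[OF K] by simp
    have "sub_le C J (\<phi> K)"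
      using that below[OF M K] below[OF M' K] least[OF phi_in_Sub[OF K]] by simp
    then show "sub_le C (\<phi> J) K"
      using phi_le_iff[OF JS K] by blast
  qed
  then show ?thesis
    using closure_in_Sub[OF JS] closure_mono[OF M JS le(1)] closure_mono[OF M' JS le(2)]
    by (simp add: is_join_def)
qed

end

theorem mainTheorem2:
  fixes C :: "('o, 'm) cat" and E :: 'o and f :: 'm
  assumes "category C"
    and "has_images C"
    and "has_pullbacks C"
    and "E \<in> Obj C"
    and "f \<in> Hom C E E"
    and "f \<cdot>\<^bsub>C\<^esub> f = Ident C E"
    and "\<forall>M \<in> Sub C E. has_join C E M (direct_image C f M)"
  shows "(\<forall>M \<in> Sub C E. sub_le C M (image_closure C E f M)) \<and>
    (\<forall>M \<in> Sub C E. image_closure C E f (image_closure C E f M) = image_closure C E f M) \<and>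
    (\<forall>M \<in> Sub C E. \<forall>M' \<in> Sub C E. has_join C E M M' \<longrightarrow>
       has_join C E (image_closure C E f M) (image_closure C E f M') \<and>
       image_closure C E f (join C E M M') =
         join C E (image_closure C E f M) (image_closure C E f M'))"
proof -
  interpret involution C E f
    using assms by (simp add: involution_def involution_axioms_def)
  have "has_join C E (cl M) (cl M') \<and> cl (join C E M M') = join C E (cl M) (cl M')"
    if "M \<in> Sub C E" "M' \<in> Sub C E" "has_join C E M M'" for M M'
  proof -
    have "is_join C E (cl M) (cl M') (cl (join C E M M'))"
      using is_join_closure_join[OF that(1,2) is_join_join[OF that(3)]] .
    then show ?thesis
      using join_eqI[of E "cl M" "cl M'"] unfolding has_join_def by metis
  qed
  then show ?thesis
    using le_closure closure_idem by simp
qed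

end
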